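(* Let $k\ge2$ and $q\ge1$. Up to isomorphism of simplicial complexes, the links of the vertices of $T_{k,q}$ are exactly the complexes in $\bigcup_{s=1}^{q}\{K_\lambda\}_{\lambda\in Par(k,s)}$; that is, every vertex link is isomorphic to some $K_\lambda$ with $\lambda$ a partition of $k$ into $s\le q$ parts, and every such $K_\lambda$ occurs as the link of some vertex.
   Context: $R_{k,q}=\{\mathbf{x}\in\mathbb{R}^{k-1}:0\le x_1\le\cdots\le x_{k-1}\le q\}$, $W_{k,q}=R_{k,q}\cap\mathbb{Z}^{k-1}$. A permutation $\pi$ of $[k-1]$ is consistent with $\mathbf{v}\in W_{k,q}$ if $i$ precedes $i+1$ in $\pi$ whenever $v_i=v_{i+1}$; then $F(\mathbf{v},\pi)$ is the simplex with vertices $\mathbf{v}^{(1)}=\mathbf{v}$, $\mathbf{v}^{(m+1)}=\mathbf{v}^{(m)}+e_{\pi_{k-m}}$ ($m=1,\dots,k-1$). $T_{k,q}$ is the simplicial complex on $W_{k,q}$ whose facets are all such $F(\mathbf{v},\pi)$; $\mathrm{link}_K(\sigma)=\{\tau\in K:\sigma\cup\tau\in K,\sigma\cap\tau=\emptyset\}$. $Par(k,s)$ is the set of partitions of $k$ into exactly $s$ positive parts. For a partition $\lambda=(\lambda_1,\ldots,\lambda_s)$, $P_\lambda=C_{\lambda_1}\times\cdots\times C_{\lambda_s}$ where $C_m$ is the chain $0<1<\cdots<m$, and $K_\lambda=\Delta(P_\lambda\setminus\{\hat0,\hat1\})$, the order complex of $P_\lambda$ with its minimum and maximum removed. *)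

theory Defs
  imports Complex_Main "HOL-Library.FuncSet" "HOL-Combinatorics.Permutations"
begin

text \<open>An abstract simplicial complex is represented by its set of faces, the empty face
  included.\<close>

definition vertices :: "'a set set \<Rightarrow> 'a set" where
  "vertices K = \<Union>K"

definition link :: "'a set set \<Rightarrow> 'a set \<Rightarrow> 'a set set" where
  "link K \<sigma> = {\<tau> \<in> K. \<sigma> \<union> \<tau> \<in> K \<and> \<sigma> \<inter> \<tau> = {}}"

definition complex_iso :: "'a set set \<Rightarrow> 'b set set \<Rightarrow> bool" where
  "complex_iso K L \<longleftrightarrow>
     (\<exists>f. bij_betw f (vertices K) (vertices L) \<and>
          (\<forall>\<sigma>. \<sigma> \<subseteq> vertices K \<longrightarrow> (\<sigma> \<in> K \<longleftrightarrow> f ` \<sigma> \<in> L)))"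

text \<open>Vectors in \<open>\<real>\<^sup>k\<^sup>-\<^sup>1\<close> are extensional functions on the index set \<open>{1..k - 1}\<close>
  (equal to \<^const>\<open>undefined\<close> elsewhere), so that equality of vectors is equality of functions.\<close>

definition R_region :: "nat \<Rightarrow> nat \<Rightarrow> (nat \<Rightarrow> real) set" where
  "R_region k q = {x \<in> {1..k - 1} \<rightarrow>\<^sub>E UNIV.
     0 \<le> x 1 \<and> (\<forall>i \<in> {1..<k - 1}. x i \<le> x (i + 1)) \<and> x (k - 1) \<le> real q}"

definition W_points :: "nat \<Rightarrow> nat \<Rightarrow> (nat \<Rightarrow> real) set" where
  "W_points k q = R_region k q \<inter> ({1..k - 1} \<rightarrow>\<^sub>E \<int>)"

text \<open>A permutation \<open>\<pi>\<close> is read as the word \<open>\<pi> 1, \<dots>, \<pi> (k - 1)\<close>; the position of the letter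
  \<open>i\<close> in this word is \<open>inv \<pi> i\<close>.\<close>

definition consistent :: "nat \<Rightarrow> (nat \<Rightarrow> real) \<Rightarrow> (nat \<Rightarrow> nat) \<Rightarrow> bool" where
  "consistent k v \<pi> \<longleftrightarrow>
     (\<forall>i \<in> {1..<k - 1}. v i = v (i + 1) \<longrightarrow> inv \<pi> i < inv \<pi> (i + 1))"

text \<open>The index is shifted by one: \<open>F_vertex k v \<pi> n\<close> is $v^{(n+1)}$.\<close>

primrec F_vertex :: "nat \<Rightarrow> (nat \<Rightarrow> real) \<Rightarrow> (nat \<Rightarrow> nat) \<Rightarrow> nat \<Rightarrow> nat \<Rightarrow> real" where
  "F_vertex k v \<pi> 0 = v"
| "F_vertex k v \<pi> (Suc n) =
     (let w = F_vertex k v \<pi> n; j = \<pi> (k - Suc n) in w(j := w j + 1))"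

definition F_simplex :: "nat \<Rightarrow> (nat \<Rightarrow> real) \<Rightarrow> (nat \<Rightarrow> nat) \<Rightarrow> (nat \<Rightarrow> real) set" where
  "F_simplex k v \<pi> = F_vertex k v \<pi> ` {0..k - 1}"

text \<open>If \<open>v (k - 1) = q\<close>, the last vertex \<open>v + (1, \<dots>, 1)\<close> of \<open>F_simplex k v \<pi>\<close> is outside the
  region. Such simplices are not simplices on \<^term>\<open>W_points k q\<close> and must be left out
  explicitly.\<close>

definition T_facets :: "nat \<Rightarrow> nat \<Rightarrow> (nat \<Rightarrow> real) set set" where
  "T_facets k q = {F_simplex k v \<pi> | v \<pi>.
     v \<in> W_points k q \<and> \<pi> permutes {1..k - 1} \<and> consistent k v \<pi> \<and>
     F_simplex k v \<pi> \<subseteq> W_points k q}"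

definition T_complex :: "nat \<Rightarrow> nat \<Rightarrow> (nat \<Rightarrow> real) set set" where
  "T_complex k q = {\<sigma>. \<exists>F \<in> T_facets k q. \<sigma> \<subseteq> F}"

definition Par :: "nat \<Rightarrow> nat \<Rightarrow> nat list set" where
  "Par k s = {ps. length ps = s \<and> sum_list ps = k \<and> (\<forall>p \<in> set ps. 0 < p) \<and> sorted_wrt (\<ge>) ps}"

text \<open>The product of chains consists of lists, ordered componentwise by
  \<^term>\<open>list_all2 (\<le>)\<close>; its minimum is the zero list and its maximum is \<open>ps\<close> itself.\<close>

definition P_poset :: "nat list \<Rightarrow> nat list set" where
  "P_poset ps = listset (map (\<lambda>m. {0..m}) ps)"

definition order_complex :: "('a \<Rightarrow> 'a \<Rightarrow> bool) \<Rightarrow> 'a set \<Rightarrow> 'a set set" where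
  "order_complex le A = {\<sigma>. finite \<sigma> \<and> \<sigma> \<subseteq> A \<and> Complete_Partial_Order.chain le \<sigma>}"

definition K_complex :: "nat list \<Rightarrow> nat list set set" where
  "K_complex ps = order_complex (list_all2 (\<le>)) (P_poset ps - {replicate (length ps) 0, ps})"

end

(* A vertex set is a face of T_{k,q} iff it is a chain in W_{k,q}, ordered componentwise, whose
   maximum exceeds its minimum by at most 1 in every coordinate; so T_{k,q} is a flag complex.
   View v as a cyclic word by putting 0 in front and q behind. The neighbours v + 1_B and v - 1_A
   of v then correspond to the nonempty proper subsets B and {0} cup A^c of Z/k that are closed under
   i -> i+1 within the cyclic blocks of equal consecutive letters, and two neighbours are adjacent
   iff these sets are nested. Such a set is determined by how many elements it has in each block,
   so the link is the order complex of the proper part of a product of chains, one for each block.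
   There are s blocks, of total length k, and s is the number of jumps in the word, hence 1 <= s <= q. *)
theory Submission
  imports Defs
begin

section \<open>Flag complexes\<close>

text \<open>The pairs with \<open>x = y\<close> are included, so a point with
  \<open>\<not> R x x\<close> is not a vertex.\<close>

definition flag_complex :: "'a set \<Rightarrow> ('a \<Rightarrow> 'a \<Rightarrow> bool) \<Rightarrow> 'a set set" where
  "flag_complex A R = {\<sigma>. finite \<sigma> \<and> \<sigma> \<subseteq> A \<and> (\<forall>x\<in>\<sigma>. \<forall>y\<in>\<sigma>. R x y)}"

lemma vertices_flag_complex:
  assumes "\<And>x. x \<in> A \<Longrightarrow> R x x"
  shows "vertices (flag_complex A R) = A"
proof
  show "A \<subseteq> vertices (flag_complex A R)"
  proof
    fix x assume "x \<in> A"
    then have "{x} \<in> flag_complex A R"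
      using assms by (simp add: flag_complex_def)
    then show "x \<in> vertices (flag_complex A R)"
      unfolding vertices_def by blast
  qed
qed (auto simp: vertices_def flag_complex_def)

lemma complex_iso_flag_complex:
  assumes bij: "bij_betw f A B"
    and reflA: "\<And>x. x \<in> A \<Longrightarrow> R x x"
    and rel: "\<And>x y. x \<in> A \<Longrightarrow> y \<in> A \<Longrightarrow> R x y \<longleftrightarrow> R' (f x) (f y)"
  shows "complex_iso (flag_complex A R) (flag_complex B R')"
proof -
  have reflB: "R' y y" if "y \<in> B" for y
    using that bij reflA rel unfolding bij_betw_def by blast
  have "\<sigma> \<in> flag_complex A R \<longleftrightarrow> f ` \<sigma> \<in> flag_complex B R'" if "\<sigma> \<subseteq> A" for \<sigma>
  proof -
    have "finite (f ` \<sigma>) \<longleftrightarrow> finite \<sigma>"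
      using bij that by (meson bij_betw_def finite_image_iff inj_on_subset)
    moreover have "f ` \<sigma> \<subseteq> B"
      using bij that by (auto simp: bij_betw_def)
    moreover have "(\<forall>x\<in>\<sigma>. \<forall>y\<in>\<sigma>. R x y) \<longleftrightarrow> (\<forall>x\<in>\<sigma>. \<forall>y\<in>\<sigma>. R' (f x) (f y))"
      using rel that by (meson subsetD)
    ultimately show ?thesis
      using that by (simp add: flag_complex_def)
  qed
  then show ?thesis
    unfolding complex_iso_def
    using bij vertices_flag_complex[of A R] vertices_flag_complex[of B R'] reflA reflB by auto
qed

text \<open>The bijection constructed later runs from the poset to the link, while the theorem wants
  an isomorphism starting at the link. Inverting it here settles the direction.\<close>

lemma complex_iso_flag_complex':
  assumes bij: "bij_betw f A B"
    and reflA: "\<And>x. x \<in> A \<Longrightarrow> R x x"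
    and rel: "\<And>x y. x \<in> A \<Longrightarrow> y \<in> A \<Longrightarrow> R x y \<longleftrightarrow> R' (f x) (f y)"
  shows "complex_iso (flag_complex B R') (flag_complex A R)"
proof (rule complex_iso_flag_complex)
  show "bij_betw (inv_into A f) B A"
    by (rule bij_betw_inv_into[OF bij])
  have *: "inv_into A f y \<in> A" "f (inv_into A f y) = y" if "y \<in> B" for y
    using that bij by (auto simp: bij_betw_def inv_into_into f_inv_into_f)
  show "R' y y" if "y \<in> B" for y
    using rel[of "inv_into A f y" "inv_into A f y"] reflA[of "inv_into A f y"] *[OF that] by simp
  show "R' x y \<longleftrightarrow> R (inv_into A f x) (inv_into A f y)" if "x \<in> B" "y \<in> B" for x y
    using rel *[OF that(1)] *[OF that(2)] by simp
qed

text \<open>Faces of a flag complex are tested on pairs, so joining \<open>v\<close> to a face only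
  adds the tests against \<open>v\<close>.\<close>

lemma link_flag_complex:
  assumes "v \<in> A" "R v v" "\<And>x. R x v \<longleftrightarrow> R v x"
  shows "link (flag_complex A R) {v} = flag_complex {x \<in> A. x \<noteq> v \<and> R v x} R"
proof -
  have "({v} \<union> \<tau> \<in> flag_complex A R \<and> {v} \<inter> \<tau> = {} \<and> \<tau> \<in> flag_complex A R) \<longleftrightarrow>
      \<tau> \<in> flag_complex {x \<in> A. x \<noteq> v \<and> R v x} R" for \<tau>
    unfolding flag_complex_def using assms(1,2) assms(3)[THEN iffD2] by blast
  then show ?thesis
    unfolding link_def by blast
qed

text \<open>Downward closure forbids elements beyond a gap, so the least number outside
  \<open>D\<close> bounds it. Applied later to sets of ranks inside one block.\<close>

lemma downset_eq_lessThan_card: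
  fixes D :: "nat set"
  assumes "finite D" "\<And>t. Suc t \<in> D \<Longrightarrow> t \<in> D"
  shows "D = {..<card D}"
proof -
  have down: "t \<in> D" if "t \<le> u" "u \<in> D" for t u
    using that by (induction u rule: dec_induct[consumes 1]) (use assms(2) in auto)
  have L: "(LEAST t. t \<notin> D) \<notin> D"
    using LeastI_ex[OF ex_new_if_finite[OF infinite_UNIV_nat assms(1)]] .
  have "t \<in> D \<longleftrightarrow> t < (LEAST t. t \<notin> D)" for t
  proof
    show "t < (LEAST t. t \<notin> D)" if "t \<in> D"
      using L down[OF _ that] by (meson not_le)
    show "t \<in> D" if "t < (LEAST t. t \<notin> D)"
      using not_less_Least[OF that] by simp
  qed
  then have "D = {..<LEAST t. t \<notin> D}" by blast
  then show ?thesis by (metis card_lessThan)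
qed

section \<open>Products of chains as sets of lists\<close>

lemma listset_iff_list_all2: "c \<in> listset As \<longleftrightarrow> list_all2 (\<in>) c As"
  by (induction As arbitrary: c) (auto simp: set_Cons_def list_all2_Cons2)

lemma P_poset_iff: "c \<in> P_poset ps \<longleftrightarrow> list_all2 (\<le>) c ps"
  by (auto simp: P_poset_def listset_iff_list_all2 list_all2_conv_all_nth)

lemma K_complex_eq_flag_complex:
  "K_complex ps = flag_complex (P_poset ps - {replicate (length ps) 0, ps})
     (\<lambda>c d. list_all2 (\<le>) c d \<or> list_all2 (\<le>) d c)"
  by (simp add: K_complex_def order_complex_def flag_complex_def chain_def)

section \<open>The complex \<open>T_complex k q\<close> as a flag complex\<close>

text \<open>Adding the entries \<open>0\<close> at index \<open>0\<close> and \<open>q\<close> at index \<open>k\<close> makes all constraints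
  defining the region instances of one monotonicity condition.\<close>

definition ext :: "nat \<Rightarrow> nat \<Rightarrow> (nat \<Rightarrow> real) \<Rightarrow> nat \<Rightarrow> real" where
  "ext k q v i = (if i = 0 then 0 else if i = k then real q else v i)"

lemma W_points_iff:
  assumes "k \<ge> 2"
  shows "v \<in> W_points k q \<longleftrightarrow>
     v \<in> {1..k - 1} \<rightarrow>\<^sub>E \<int> \<and> (\<forall>i<k. ext k q v i \<le> ext k q v (Suc i))"
proof -
  have "(0 \<le> v 1 \<and> (\<forall>i \<in> {1..<k - 1}. v i \<le> v (i + 1)) \<and> v (k - 1) \<le> real q)
     \<longleftrightarrow> (\<forall>i<k. ext k q v i \<le> ext k q v (Suc i))" (is "?L \<longleftrightarrow> ?R")
  proof
    assume L: ?L
    show ?R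
    proof (intro allI impI)
      fix i assume "i < k"
      then consider "i = 0" | "i = k - 1" "i \<noteq> 0" | "i \<in> {1..<k - 1}" by force
      then show "ext k q v i \<le> ext k q v (Suc i)"
        using L assms by cases (auto simp: ext_def)
    qed
  next
    assume R: ?R
    have "ext k q v 0 \<le> ext k q v (Suc 0)" "ext k q v (k - 1) \<le> ext k q v (Suc (k - 1))"
      using R[rule_format, of 0] R[rule_format, of "k - 1"] assms by auto
    moreover have "v i \<le> v (i + 1)" if "i \<in> {1..<k - 1}" for i
      using R[rule_format, of i] that by (cases "Suc i = k") (auto simp: ext_def)
    ultimately show ?L
      using assms by (auto simp: ext_def split: if_splits)
  qed
  then show ?thesis
    by (auto simp: W_points_def R_region_def PiE_def Pi_def)
qed

lemma ext_Ints:
  assumes "v \<in> {1..k - 1} \<rightarrow>\<^sub>E \<int>" "i \<le> k"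
  shows "ext k q v i \<in> \<int>"
  using assms by (auto simp: ext_def PiE_def Pi_def)

lemma Ints_less_imp_add_one_le:
  fixes x y :: real
  assumes "x \<in> \<int>" "y \<in> \<int>" "x < y"
  shows "x + 1 \<le> y"
  using assms by (auto elim!: Ints_cases)

section \<open>Adjacency of lattice points and the vertices of a simplex\<close>

text \<open>For lattice points this says that \<open>y - x\<close> is a 0/1-vector.\<close>

definition below :: "nat \<Rightarrow> (nat \<Rightarrow> real) \<Rightarrow> (nat \<Rightarrow> real) \<Rightarrow> bool" where
  "below k x y \<longleftrightarrow> (\<forall>i\<in>{1..k - 1}. x i \<le> y i \<and> y i \<le> x i + 1)"

lemma below_cases:
  assumes "x \<in> W_points k q" "y \<in> W_points k q" "below k x y" "i \<in> {1..k - 1}"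
  shows "y i = x i \<or> y i = x i + 1"
proof -
  have "x i \<in> \<int>" "y i \<in> \<int>"
    using assms(1,2,4) by (auto simp: W_points_def PiE_def Pi_def)
  moreover have "x i \<le> y i" "y i \<le> x i + 1"
    using assms(3,4) by (auto simp: below_def)
  ultimately show ?thesis
    using Ints_less_imp_add_one_le[of "x i" "y i"] by linarith
qed

definition adj :: "nat \<Rightarrow> (nat \<Rightarrow> real) \<Rightarrow> (nat \<Rightarrow> real) \<Rightarrow> bool" where
  "adj k x y \<longleftrightarrow> below k x y \<or> below k y x"

lemma adj_refl: "adj k x x"
  by (simp add: adj_def below_def)

lemma adj_commute: "adj k x y \<longleftrightarrow> adj k y x"
  by (auto simp: adj_def)

text \<open>The word \<open>\<pi>\<close> is consumed from its last letter backwards: step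
  \<open>n\<close> raises the letter at position \<open>k - n\<close>. After \<open>n\<close> steps
  the letters in the last \<open>n\<close> positions have been raised.\<close>

lemma F_vertex_eq:
  assumes "\<pi> permutes {1..k - 1}" "n \<le> k - 1"
  shows "F_vertex k v \<pi> n = (\<lambda>i. v i + of_bool (i \<in> {1..k - 1} \<and> k - n \<le> inv \<pi> i))"
  using assms(2)
proof (induction n)
  case 0
  have "inv \<pi> i \<in> {1..k - 1}" if "i \<in> {1..k - 1}" for i
    using permutes_in_image[OF permutes_inv[OF assms(1)], of i] that by simp
  then show ?case by (force simp: fun_eq_iff)
next
  case (Suc n)
  let ?j = "\<pi> (k - Suc n)"
  have j: "?j \<in> {1..k - 1}" "inv \<pi> ?j = k - Suc n"
    using permutes_in_image[OF assms(1), of "k - Suc n"] permutes_inverses(2)[OF assms(1)] Suc.prems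
    by auto
  have "inv \<pi> i = k - Suc n \<longleftrightarrow> i = ?j" for i
    using permutes_inv_eq[OF assms(1)] by metis
  moreover have "k - Suc n \<le> a \<longleftrightarrow> k - n \<le> a \<or> a = k - Suc n" for a
    using Suc.prems by linarith
  ultimately have "k - Suc n \<le> inv \<pi> i \<longleftrightarrow> k - n \<le> inv \<pi> i \<or> i = ?j" for i
    by simp
  then show ?case
    using Suc j by (auto simp: Let_def fun_eq_iff)
qed

text \<open>All vertices are \<open>v\<close> plus indicators of final segments of the word, and
  final segments are nested.\<close>

lemma adj_F_simplex:
  assumes "\<pi> permutes {1..k - 1}" "x \<in> F_simplex k v \<pi>" "y \<in> F_simplex k v \<pi>"
  shows "adj k x y"
proof -
  obtain m n where "m \<le> k - 1" "x = F_vertex k v \<pi> m" "n \<le> k - 1" "y = F_vertex k v \<pi> n"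
    using assms(2,3) by (auto simp: F_simplex_def)
  then have x: "x = (\<lambda>i. v i + of_bool (i \<in> {1..k - 1} \<and> k - m \<le> inv \<pi> i))"
    and y: "y = (\<lambda>i. v i + of_bool (i \<in> {1..k - 1} \<and> k - n \<le> inv \<pi> i))"
    using F_vertex_eq[OF assms(1)] by auto
  show ?thesis
  proof (cases "m \<le> n")
    case True
    then have "below k x y" unfolding x y below_def by (auto simp: of_bool_def)
    then show ?thesis by (simp add: adj_def)
  next
    case False
    then have "below k y x" unfolding x y below_def by (auto simp: of_bool_def)
    then show ?thesis by (simp add: adj_def)
  qed
qed

section \<open>A facet through a given face\<close>

text \<open>Sort the letters by increasing \<open>\<kappa>\<close>, so that the position of a letter
  is its rank. A set closed under passing to larger \<open>\<kappa>\<close> fills the last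
  positions; as positions end at \<open>k - 1\<close>, it starts at
  \<open>k - card B\<close>.\<close>

lemma ex_ranking_permutation:
  fixes \<kappa> :: "nat \<Rightarrow> nat"
  assumes inj: "inj_on \<kappa> {1..k - 1}"
  obtains \<pi> where "\<pi> permutes {1..k - 1}"
    and "\<And>i j. i \<in> {1..k - 1} \<Longrightarrow> j \<in> {1..k - 1} \<Longrightarrow> \<kappa> i < \<kappa> j \<Longrightarrow> inv \<pi> i < inv \<pi> j"
    and "\<And>B. B \<subseteq> {1..k - 1} \<Longrightarrow> (\<And>i j. i \<in> B \<Longrightarrow> j \<in> {1..k - 1} \<Longrightarrow> \<kappa> i \<le> \<kappa> j \<Longrightarrow> j \<in> B) \<Longrightarrow>
      B = {i \<in> {1..k - 1}. k - card B \<le> inv \<pi> i}"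
proof -
  let ?I = "{1..k - 1}"
  \<comment> \<open>The rank, counted from 1 and extended by the identity so as to be a permutation;
    the word is its inverse.\<close>
  define p where "p i = (if i \<in> ?I then card {j \<in> ?I. \<kappa> j \<le> \<kappa> i} else i)" for i
  have less: "p i < p j" if "i \<in> ?I" "j \<in> ?I" "\<kappa> i < \<kappa> j" for i j
  proof -
    have "j \<in> {l \<in> ?I. \<kappa> l \<le> \<kappa> j}" "j \<notin> {l \<in> ?I. \<kappa> l \<le> \<kappa> i}"
      using that by auto
    moreover have "{l \<in> ?I. \<kappa> l \<le> \<kappa> i} \<subseteq> {l \<in> ?I. \<kappa> l \<le> \<kappa> j}"
      using that by auto
    ultimately have "{l \<in> ?I. \<kappa> l \<le> \<kappa> i} \<subset> {l \<in> ?I. \<kappa> l \<le> \<kappa> j}"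
      by blast
    then show ?thesis
      using that by (simp add: p_def psubset_card_mono)
  qed
  have injp: "inj_on p ?I"
    using less inj by (metis (no_types, lifting) inj_onI inj_onD less_irrefl linorder_neqE_nat)
  have "p ` ?I \<subseteq> ?I"
  proof
    fix m assume "m \<in> p ` ?I"
    then obtain i where i: "i \<in> ?I" "m = card {j \<in> ?I. \<kappa> j \<le> \<kappa> i}"
      by (auto simp: p_def)
    have "m \<le> card ?I" unfolding i(2) by (rule card_mono) auto
    moreover have "card {i} \<le> m" unfolding i(2) using i(1) by (intro card_mono) auto
    ultimately show "m \<in> ?I" by simp
  qed
  then have "p permutes ?I"
    using injp endo_inj_surj[of ?I p] by (intro bij_imp_permutes) (auto simp: bij_betw_def p_def)
  then have perm: "inv p permutes ?I" and inv: "inv (inv p) = p"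
    by (auto simp: permutes_inv permutes_inv_inv)
  show ?thesis
  proof (rule that[OF perm])
    fix B assume B: "B \<subseteq> ?I" "\<And>i j. i \<in> B \<Longrightarrow> j \<in> ?I \<Longrightarrow> \<kappa> i \<le> \<kappa> j \<Longrightarrow> j \<in> B"
    have finB: "finite B" using B(1) finite_subset by blast
    have pe: "p i + card {j \<in> ?I. \<kappa> i < \<kappa> j} = k - 1" if "i \<in> ?I" for i
    proof -
      have "card ?I = card ({j \<in> ?I. \<kappa> j \<le> \<kappa> i} \<union> {j \<in> ?I. \<kappa> i < \<kappa> j})"
        by (rule arg_cong[of _ _ card]) auto
      also have "\<dots> = card {j \<in> ?I. \<kappa> j \<le> \<kappa> i} + card {j \<in> ?I. \<kappa> i < \<kappa> j}"
        by (rule card_Un_disjoint) auto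
      finally show ?thesis using that by (simp add: p_def)
    qed
    have "i \<in> B \<longleftrightarrow> k - card B \<le> p i" if i: "i \<in> ?I" for i
    proof
      assume "i \<in> B"
      then have "{j \<in> ?I. \<kappa> i < \<kappa> j} \<subset> B" using B i by force
      then have "card {j \<in> ?I. \<kappa> i < \<kappa> j} < card B" using finB psubset_card_mono by blast
      then show "k - card B \<le> p i" using pe[OF i] by linarith
    next
      assume *: "k - card B \<le> p i"
      show "i \<in> B"
      proof (rule ccontr)
        assume "i \<notin> B"
        then have "\<kappa> i < \<kappa> j" if "j \<in> B" for j
          using B(2)[OF that i] by (cases "\<kappa> j \<le> \<kappa> i") auto
        then have "B \<subseteq> {j \<in> ?I. \<kappa> i < \<kappa> j}" using B(1) by blast
        then have "card B \<le> card {j \<in> ?I. \<kappa> i < \<kappa> j}" by (intro card_mono) auto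
        then show False using pe[OF i] * i by auto
      qed
    qed
    then show "B = {i \<in> ?I. k - card B \<le> inv (inv p) i}" using B(1) inv by auto
  qed (use less inv in auto)
qed

text \<open>Integrality makes every strict increase of \<open>v\<close> at least 1, so raising
  coordinates by 1 endangers monotonicity only between equal neighbours, which \<open>up\<close>
  covers. The bound \<open>top\<close> guards the last coordinate.\<close>

lemma W_points_add_indicator:
  assumes k: "k \<ge> 2" and v: "v \<in> W_points k q" and top: "v (k - 1) + 1 \<le> real q"
    and B: "B \<subseteq> {1..k - 1}"
    and up: "\<And>i. i \<in> {1..<k - 1} \<Longrightarrow> v i = v (i + 1) \<Longrightarrow> i \<in> B \<Longrightarrow> i + 1 \<in> B"
  shows "(\<lambda>i. v i + of_bool (i \<in> B)) \<in> W_points k q"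
proof -
  let ?x = "\<lambda>i. v i + of_bool (i \<in> B)"
  have vE: "v \<in> {1..k - 1} \<rightarrow>\<^sub>E \<int>" and mono: "\<And>i. i < k \<Longrightarrow> ext k q v i \<le> ext k q v (Suc i)"
    using v W_points_iff[OF k] by auto
  have "?x \<in> {1..k - 1} \<rightarrow>\<^sub>E \<int>"
    using vE B by (auto simp: PiE_def Pi_def extensional_def)
  moreover have "ext k q ?x i \<le> ext k q ?x (Suc i)" if i: "i < k" for i
  proof -
    consider "i = 0" | "i = k - 1" "i \<noteq> 0" | "i \<in> {1..<k - 1}" using i by force
    then show ?thesis
    proof cases
      case 1
      then show ?thesis using mono[of 0] k by (simp add: ext_def)
    next
      case 2
      then show ?thesis using top k by (simp add: ext_def)
    next
      case 3
      then have "v i \<le> v (i + 1)"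
        using mono[of i] by (cases "Suc i = k") (auto simp: ext_def)
      moreover have "v i + 1 \<le> v (i + 1)" if "v i < v (i + 1)"
        using that vE 3 by (intro Ints_less_imp_add_one_le) (auto simp: PiE_def Pi_def)
      ultimately have "v i + of_bool (i \<in> B) \<le> v (i + 1) + of_bool (i + 1 \<in> B)"
        using up[OF 3] by (cases "v i = v (i + 1)") (auto simp: of_bool_def)
      then show ?thesis using 3 by (auto simp: ext_def)
    qed
  qed
  ultimately show ?thesis
    using W_points_iff[OF k] by blast
qed

text \<open>The coordinatewise minimum is a lower corner of the face, and pairwise adjacency keeps
  every point within 1 of it. Different coordinates may attain it at different points, so
  \<open>v\<close> need not lie in the face.\<close>

lemma ex_facet_base:
  assumes k: "k \<ge> 2" and q: "q \<ge> 1" and \<sigma>: "\<sigma> \<in> flag_complex (W_points k q) (adj k)" "\<sigma> \<noteq> {}"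
  obtains v where "v \<in> W_points k q" "v (k - 1) + 1 \<le> real q" "\<And>x. x \<in> \<sigma> \<Longrightarrow> below k v x"
proof -
  let ?I = "{1..k - 1}"
  have fin: "finite \<sigma>" and W: "\<And>x. x \<in> \<sigma> \<Longrightarrow> x \<in> W_points k q"
    and adj: "\<And>x y. x \<in> \<sigma> \<Longrightarrow> y \<in> \<sigma> \<Longrightarrow> adj k x y"
    using \<sigma>(1) by (auto simp: flag_complex_def)
  \<comment> \<open>The cap \<open>q - 1\<close> leaves room for the last vertex
    \<open>v + (1, ..., 1)\<close> of the facet; points stay within 1 of \<open>v\<close> because
    their coordinates are at most \<open>q\<close>.\<close>
  define v where "v = (\<lambda>i\<in>?I. min (Min ((\<lambda>x. x i) ` \<sigma>)) (real q - 1))"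
  have E: "x \<in> ?I \<rightarrow>\<^sub>E \<int>" and pos: "0 \<le> x 1" and top: "x (k - 1) \<le> real q"
    and mono: "i \<in> {1..<k - 1} \<Longrightarrow> x i \<le> x (i + 1)" if "x \<in> \<sigma>" for x i
    using W[OF that] by (auto simp: W_points_def R_region_def)
  have v_attained: "\<exists>x\<in>\<sigma>. v i = min (x i) (real q - 1)" if "i \<in> ?I" for i
  proof -
    have "Min ((\<lambda>x. x i) ` \<sigma>) \<in> (\<lambda>x. x i) ` \<sigma>"
      using fin \<sigma>(2) by (intro Min_in) auto
    then show ?thesis using that by (auto simp: v_def)
  qed
  have v_le: "v i \<le> x i" "v i \<le> real q - 1" if "i \<in> ?I" "x \<in> \<sigma>" for i x
    using that fin by (auto simp: v_def intro: min.coboundedI1)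
  have le_q: "x i \<le> real q" if "i \<in> ?I" "x \<in> \<sigma>" for i x
  proof -
    have "x i \<le> x (k - 1)"
    proof (rule dec_induct[of i "k - 1" "\<lambda>j. x i \<le> x j"])
      show "i \<le> k - 1" using that by simp
      show "x i \<le> x (Suc j)" if "i \<le> j" "j < k - 1" "x i \<le> x j" for j
        using mono[of x j] that \<open>i \<in> ?I\<close> \<open>x \<in> \<sigma>\<close> by fastforce
    qed simp
    then show ?thesis using top that by force
  qed
  have "v \<in> ?I \<rightarrow>\<^sub>E \<int>"
  proof (rule PiE_I)
    fix i assume "i \<in> ?I"
    then obtain x where x: "x \<in> \<sigma>" "v i = min (x i) (real q - 1)"
      using v_attained by blast
    moreover have "x i \<in> \<int>" using E[OF x(1)] \<open>i \<in> ?I\<close> by (auto simp: PiE_def Pi_def)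
    ultimately show "v i \<in> \<int>" by (auto simp: min_def)
  qed (auto simp: v_def)
  moreover have "0 \<le> v 1"
    using v_attained[of 1] pos k q by force
  moreover have "v i \<le> v (i + 1)" if i: "i \<in> {1..<k - 1}" for i
  proof -
    obtain x where x: "x \<in> \<sigma>" "v (i + 1) = min (x (i + 1)) (real q - 1)"
      using v_attained[of "i + 1"] i by auto
    then show ?thesis using v_le[of i x] mono[OF x(1) i] i by auto
  qed
  moreover have top': "v (k - 1) + 1 \<le> real q"
    using v_le(2)[of "k - 1"] \<sigma>(2) k by fastforce
  ultimately have "v \<in> W_points k q"
    by (auto simp: W_points_def R_region_def PiE_def)
  moreover have "below k v x" if x: "x \<in> \<sigma>" for x
    unfolding below_def
  proof (intro ballI conjI)
    fix i assume i: "i \<in> ?I"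
    show "v i \<le> x i" using v_le i x by simp
    obtain y where y: "y \<in> \<sigma>" "v i = min (y i) (real q - 1)"
      using v_attained[OF i] by blast
    have "x i \<le> y i + 1"
      using adj[OF x y(1)] i unfolding adj_def below_def by force
    then show "x i \<le> v i + 1" using y(2) le_q[OF i x] by simp
  qed
  ultimately show ?thesis using that top' by blast
qed

text \<open>Relative to the base vertex \<open>v\<close>, a face is a chain of \<open>0/1\<close>-vectors. Listing the
  coordinates by how many of these vectors use them, with ties broken by index, turns all
  the supports into final segments of the word \<open>\<pi>\<close>, and monotonicity of the vectors makes
  \<open>\<pi>\<close> consistent with \<open>v\<close>.\<close>

lemma ex_facet_superset:
  assumes k: "k \<ge> 2" and q: "q \<ge> 1" and \<sigma>: "\<sigma> \<in> flag_complex (W_points k q) (adj k)" "\<sigma> \<noteq> {}"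
  shows "\<exists>F\<in>T_facets k q. \<sigma> \<subseteq> F"
proof -
  let ?I = "{1..k - 1}"
  obtain v where v: "v \<in> W_points k q" "v (k - 1) + 1 \<le> real q" "\<And>x. x \<in> \<sigma> \<Longrightarrow> below k v x"
    using ex_facet_base[OF assms] by blast
  have fin: "finite \<sigma>" and W: "\<And>x. x \<in> \<sigma> \<Longrightarrow> x \<in> W_points k q"
    and adj: "\<And>x y. x \<in> \<sigma> \<Longrightarrow> y \<in> \<sigma> \<Longrightarrow> adj k x y"
    using \<sigma>(1) by (auto simp: flag_complex_def)
  have E: "x \<in> ?I \<rightarrow>\<^sub>E \<int>"
    and mono: "i \<in> {1..<k - 1} \<Longrightarrow> x i \<le> x (i + 1)" if "x \<in> W_points k q" for x i
    using that by (auto simp: W_points_def R_region_def)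
  define B where "B x = {i \<in> ?I. x i = v i + 1}" for x
  have x_eq: "x i = v i + of_bool (i \<in> B x)" if "x \<in> \<sigma>" for x i
  proof (cases "i \<in> ?I")
    case True
    have "x i = v i \<or> x i = v i + 1"
      using below_cases[OF v(1) W[OF that] v(3)[OF that] True] .
    then show ?thesis using True by (auto simp: B_def)
  next
    case False
    then show ?thesis using E[OF v(1)] E[OF W[OF that]] by (auto simp: B_def PiE_def extensional_def)
  qed
  have B_chain: "B x \<subseteq> B y \<or> B y \<subseteq> B x" if "x \<in> \<sigma>" "y \<in> \<sigma>" for x y
  proof -
    have "B x \<subseteq> B y" if "x \<in> \<sigma>" "y \<in> \<sigma>" "below k x y" for x y
    proof
      fix i assume i: "i \<in> B x"
      then have "x i \<le> y i"
        using that(3) unfolding below_def B_def by blast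
      then show "i \<in> B y"
        using x_eq[OF that(1), of i] x_eq[OF that(2), of i] i by (cases "i \<in> B y") auto
    qed
    then show ?thesis using adj[OF that] that by (auto simp: adj_def)
  qed
  define w where "w i = card {x \<in> \<sigma>. i \<in> B x}" for i
  \<comment> \<open>Since \<open>i < k\<close>, comparing \<open>\<kappa>\<close> means comparing
    the pairs \<open>(w i, i)\<close> lexicographically.\<close>
  define \<kappa> where "\<kappa> i = w i * k + i" for i
  have \<kappa>_lex: "\<kappa> i < \<kappa> j" if "w i < w j" "i \<in> ?I" for i j
  proof -
    have "\<kappa> i < Suc (w i) * k" using that k unfolding \<kappa>_def by simp linarith
    also have "\<dots> \<le> w j * k" using that by (intro mult_le_mono1) simp
    finally show ?thesis by (simp add: \<kappa>_def)
  qed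
  have inj: "inj_on \<kappa> ?I"
  proof (rule inj_onI)
    fix i j assume "i \<in> ?I" "j \<in> ?I" "\<kappa> i = \<kappa> j"
    then show "i = j" using \<kappa>_lex[of i j] \<kappa>_lex[of j i]
      by (cases "w i" "w j" rule: linorder_cases) (auto simp: \<kappa>_def)
  qed
  have up: "j \<in> B x" if "x \<in> \<sigma>" "i \<in> B x" "j \<in> ?I" "\<kappa> i \<le> \<kappa> j" for x i j
  proof (rule ccontr)
    assume j: "j \<notin> B x"
    \<comment> \<open>A support containing \<open>j\<close> is not inside \<open>B x\<close>, hence
      contains \<open>B x\<close> and with it \<open>i\<close>. The inclusion is strict because
      \<open>x\<close> itself is only on the right.\<close>
    have "{y \<in> \<sigma>. j \<in> B y} \<subset> {y \<in> \<sigma>. i \<in> B y}"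
      using B_chain[OF that(1)] that(1,2) j by blast
    then have "w j < w i" unfolding w_def using fin by (intro psubset_card_mono) auto
    then show False using \<kappa>_lex[of j i] that by simp
  qed
  obtain \<pi> where \<pi>: "\<pi> permutes ?I"
    and less: "\<And>i j. i \<in> ?I \<Longrightarrow> j \<in> ?I \<Longrightarrow> \<kappa> i < \<kappa> j \<Longrightarrow> inv \<pi> i < inv \<pi> j"
    and seg: "\<And>B. B \<subseteq> ?I \<Longrightarrow> (\<And>i j. i \<in> B \<Longrightarrow> j \<in> ?I \<Longrightarrow> \<kappa> i \<le> \<kappa> j \<Longrightarrow> j \<in> B) \<Longrightarrow>
      B = {i \<in> ?I. k - card B \<le> inv \<pi> i}"
    using ex_ranking_permutation[OF inj] by blast
  have cons: "inv \<pi> i < inv \<pi> (i + 1)" if i: "i \<in> {1..<k - 1}" "v i = v (i + 1)" for i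
  proof -
    have "i + 1 \<in> B x" if "x \<in> \<sigma>" "i \<in> B x" for x
      using mono[OF W[OF that(1)] i(1)] x_eq[OF that(1), of i] x_eq[OF that(1), of "i + 1"] i that
      by (cases "i + 1 \<in> B x") auto
    then have "w i \<le> w (i + 1)" unfolding w_def using fin by (intro card_mono) auto
    then have "\<kappa> i < \<kappa> (i + 1)" unfolding \<kappa>_def by (intro add_le_less_mono mult_le_mono1) auto
    then show ?thesis using less i by auto
  qed
  have "F_vertex k v \<pi> n \<in> W_points k q" if "n \<le> k - 1" for n
  proof -
    let ?B = "{i \<in> ?I. k - n \<le> inv \<pi> i}"
    have "(\<lambda>i. v i + of_bool (i \<in> ?B)) \<in> W_points k q"
      using cons by (intro W_points_add_indicator[OF k v(1,2)]) fastforce+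
    then show ?thesis using F_vertex_eq[OF \<pi> that] by simp
  qed
  then have "F_simplex k v \<pi> \<subseteq> W_points k q"
    unfolding F_simplex_def by auto
  moreover have "consistent k v \<pi>"
    using cons by (simp add: consistent_def)
  ultimately have "F_simplex k v \<pi> \<in> T_facets k q"
    using v(1) \<pi> unfolding T_facets_def by blast
  moreover have "\<sigma> \<subseteq> F_simplex k v \<pi>"
  proof
    fix x assume x: "x \<in> \<sigma>"
    have "card (B x) \<le> card ?I" by (intro card_mono) (auto simp: B_def)
    then have n: "card (B x) \<le> k - 1" by simp
    have "B x = {i \<in> ?I. k - card (B x) \<le> inv \<pi> i}"
      using up[OF x] by (intro seg) (auto simp: B_def)
    then have "i \<in> B x \<longleftrightarrow> i \<in> ?I \<and> k - card (B x) \<le> inv \<pi> i" for i by blast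
    then have "x = F_vertex k v \<pi> (card (B x))"
      unfolding F_vertex_eq[OF \<pi> n] using x_eq[OF x] by (simp add: fun_eq_iff)
    then show "x \<in> F_simplex k v \<pi>" using n unfolding F_simplex_def by auto
  qed
  ultimately show ?thesis by blast
qed

lemma T_complex_eq_flag_complex:
  assumes k: "k \<ge> 2" and q: "q \<ge> 1"
  shows "T_complex k q = flag_complex (W_points k q) (adj k)"
proof (intro equalityI subsetI)
  fix \<sigma> assume "\<sigma> \<in> T_complex k q"
  then obtain v \<pi> where "\<pi> permutes {1..k - 1}" "\<sigma> \<subseteq> F_simplex k v \<pi>" "F_simplex k v \<pi> \<subseteq> W_points k q"
    by (auto simp: T_complex_def T_facets_def)
  moreover from this have "finite \<sigma>" by (auto simp: F_simplex_def intro: finite_subset)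
  ultimately show "\<sigma> \<in> flag_complex (W_points k q) (adj k)"
    unfolding flag_complex_def using adj_F_simplex by blast
next
  fix \<sigma> assume \<sigma>: "\<sigma> \<in> flag_complex (W_points k q) (adj k)"
  \<comment> \<open>The empty face must lie in a facet too; one through the zero vector
    serves.\<close>
  let ?o = "\<lambda>i\<in>{1..k - 1}. 0 :: real"
  have "?o \<in> W_points k q" using k by (auto simp: W_points_def R_region_def)
  then have o: "{?o} \<in> flag_complex (W_points k q) (adj k)"
    by (simp add: flag_complex_def adj_refl)
  show "\<sigma> \<in> T_complex k q"
    using ex_facet_superset[OF k q \<sigma>] ex_facet_superset[OF k q o]
    by (cases "\<sigma> = {}") (auto simp: T_complex_def)
qed

section \<open>The link of a vertex\<close>

text \<open>Cyclically, the word \<open>0, v\<^sub>1, \<dots>, v\<^sub>k\<^sub>-\<^sub>1\<close>, followed by \<open>q\<close>, splits into maximal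
  constant blocks; \<open>b i\<close> is the block of the position \<open>i\<close> and \<open>r i\<close> its distance to the
  end of its block.\<close>

locale cyclic_blocks =
  fixes k q :: nat and v :: "nat \<Rightarrow> real" and ps :: "nat list" and b r :: "nat \<Rightarrow> nat"
  assumes k: "k \<ge> 2" and v: "v \<in> W_points k q"
    and bij: "bij_betw (\<lambda>i. (b i, r i)) {..<k} {(j, t). j < length ps \<and> t < ps ! j}"
    and step: "\<And>i. i < k \<Longrightarrow> ext k q v i = ext k q v (Suc i) \<Longrightarrow>
      b (Suc i mod k) = b i \<and> r i = Suc (r (Suc i mod k))"
    and jump: "\<And>i. i < k \<Longrightarrow> ext k q v i \<noteq> ext k q v (Suc i) \<Longrightarrow> r i = 0"
begin

text \<open>The word is read cyclically, so \<open>k - 1\<close> is followed by \<open>0\<close>,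
  and closure is asked only inside blocks. This is what keeps \<open>shift S\<close> weakly
  increasing.\<close>

definition upset :: "nat set \<Rightarrow> bool" where
  "upset S \<longleftrightarrow> S \<subseteq> {..<k} \<and> (\<forall>i\<in>S. ext k q v i = ext k q v (Suc i) \<longrightarrow> Suc i mod k \<in> S)"

text \<open>Closure under successors fills a block from its end backwards, so the numbers
  \<open>c ! j\<close> of elements taken from the blocks determine the set.\<close>

definition upset_of :: "nat list \<Rightarrow> nat set" where
  "upset_of c = {i. i < k \<and> r i < c ! b i}"

text \<open>This is \<open>v\<close> plus the indicator of \<open>S \<subseteq> {0..<k}\<close>, seen in \<open>\<int>\<^sup>k\<close> modulo the all-ones
  vector and normalised to have entry \<open>0\<close> at index \<open>0\<close>. So a neighbour above \<open>v\<close> comes from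
  a set without \<open>0\<close> and a neighbour below \<open>v\<close> from a set with \<open>0\<close>.\<close>

definition shift :: "nat set \<Rightarrow> nat \<Rightarrow> real" where
  "shift S = (\<lambda>i\<in>{1..k - 1}. v i + of_bool (i \<in> S) - of_bool (0 \<in> S))"

lemma b_r_bounds: "i < k \<Longrightarrow> b i < length ps \<and> r i < ps ! b i"
  using bij by (auto simp: bij_betw_def)

lemma ex_position:
  assumes "j < length ps" "t < ps ! j"
  obtains i where "i < k" "b i = j" "r i = t"
proof -
  have "(j, t) \<in> (\<lambda>i. (b i, r i)) ` {..<k}"
    using bij assms by (auto simp: bij_betw_def)
  then show ?thesis using that by auto
qed

lemma position_unique: "i < k \<Longrightarrow> i' < k \<Longrightarrow> b i = b i' \<Longrightarrow> r i = r i' \<Longrightarrow> i = i'"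
  using bij by (auto simp: bij_betw_def inj_on_def)

lemma upset_of_subset_iff:
  assumes "c \<in> P_poset ps" "d \<in> P_poset ps"
  shows "upset_of c \<subseteq> upset_of d \<longleftrightarrow> list_all2 (\<le>) c d"
proof
  have len: "length c = length ps" "length d = length ps"
    using assms by (auto simp: P_poset_iff list_all2_lengthD)
  { assume sub: "upset_of c \<subseteq> upset_of d"
    have "c ! j \<le> d ! j" if j: "j < length ps" for j
    proof (rule ccontr)
      assume *: "\<not> c ! j \<le> d ! j"
      \<comment> \<open>The element of block \<open>j\<close> at distance \<open>d ! j\<close> from
        its end lies in \<open>upset_of c\<close> but not in \<open>upset_of d\<close>.\<close>
      have "c ! j \<le> ps ! j" using assms(1) j len by (auto simp: P_poset_iff list_all2_conv_all_nth)
      then obtain i where "i < k" "b i = j" "r i = d ! j"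
        using ex_position[of j "d ! j"] j * by auto
      then show False using sub * by (auto simp: upset_of_def)
    qed
    then show "list_all2 (\<le>) c d" using len by (simp add: list_all2_conv_all_nth) }
  { assume le: "list_all2 (\<le>) c d"
    show "upset_of c \<subseteq> upset_of d"
    proof
      fix i assume i: "i \<in> upset_of c"
      then have "c ! b i \<le> d ! b i"
        using le b_r_bounds[of i] len by (auto simp: list_all2_conv_all_nth upset_of_def)
      then show "i \<in> upset_of d" using i by (auto simp: upset_of_def)
    qed }
qed

lemma inj_on_upset_of: "inj_on upset_of (P_poset ps)"
proof (rule inj_onI)
  fix c d assume "c \<in> P_poset ps" "d \<in> P_poset ps" "upset_of c = upset_of d"
  then have "list_all2 (\<le>) c d" "list_all2 (\<le>) d c"
    using upset_of_subset_iff by auto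
  then show "c = d"
    by (intro nth_equalityI) (auto simp: list_all2_conv_all_nth intro: antisym)
qed

lemma upset_of_bot: "upset_of (replicate (length ps) 0) = {}"
  using b_r_bounds by (auto simp: upset_of_def)

lemma upset_of_top: "upset_of ps = {..<k}"
  using b_r_bounds by (auto simp: upset_of_def)

lemma bot_top_in_P_poset: "replicate (length ps) 0 \<in> P_poset ps" "ps \<in> P_poset ps"
  by (auto simp: P_poset_iff list_all2_conv_all_nth)

lemma upset_upset_of: "upset (upset_of c)"
proof -
  have "Suc i mod k \<in> upset_of c" if "i \<in> upset_of c" "ext k q v i = ext k q v (Suc i)" for i
    using that step[of i] k by (auto simp: upset_of_def)
  then show ?thesis by (auto simp: upset_def upset_of_def)
qed

text \<open>Passing to the successor inside a block lowers \<open>r\<close> by 1, so closure makes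
  the ranks used in a block an initial segment; its length is the entry of \<open>c\<close>.\<close>

lemma ex_upset_of_eq:
  assumes S: "upset S"
  shows "\<exists>c\<in>P_poset ps. upset_of c = S"
proof -
  define D where "D j = r ` {i \<in> S. b i = j}" for j
  have Sk: "i < k" if "i \<in> S" for i using S that by (auto simp: upset_def)
  have D_sub: "D j \<subseteq> {..<ps ! j}" for j
    using b_r_bounds Sk by (auto simp: D_def)
  have D: "D j = {..<card (D j)}" for j
  proof (rule downset_eq_lessThan_card)
    show "finite (D j)" using D_sub finite_subset by blast
    fix t assume "Suc t \<in> D j"
    then obtain i where i: "i \<in> S" "b i = j" "r i = Suc t" by (auto simp: D_def)
    then have E: "ext k q v i = ext k q v (Suc i)" using jump[of i] Sk by force
    then have "Suc i mod k \<in> S" using S i by (auto simp: upset_def)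
    then show "t \<in> D j" using step[OF Sk[OF i(1)] E] i by (auto simp: D_def)
  qed
  define c where "c = map (\<lambda>j. card (D j)) [0..<length ps]"
  have "card (D j) \<le> ps ! j" for j
    using card_mono[OF _ D_sub[of j]] by simp
  then have "c \<in> P_poset ps"
    by (auto simp: c_def P_poset_iff list_all2_conv_all_nth)
  moreover have "i \<in> upset_of c \<longleftrightarrow> i \<in> S" if i: "i < k" for i
  proof -
    have "i \<in> upset_of c \<longleftrightarrow> r i < card (D (b i))"
      using i b_r_bounds by (auto simp: upset_of_def c_def)
    also have "\<dots> \<longleftrightarrow> r i \<in> D (b i)" using D[of "b i"] by blast
    also have "\<dots> \<longleftrightarrow> i \<in> S" using position_unique[of i] i Sk by (force simp: D_def)
    finally show ?thesis .
  qed
  then have "upset_of c = S" using Sk by (auto simp: upset_of_def)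
  ultimately show ?thesis by blast
qed

section \<open>Neighbours of the vertex as shifts\<close>

lemma v_eq_shift: "v = shift {}"
  using v by (auto simp: shift_def fun_eq_iff W_points_def PiE_def extensional_def)

text \<open>Index \<open>k\<close> is identified with \<open>0\<close>, hence the
  \<open>mod k\<close>: the correction vanishes at both ends, which keep the values 0 and
  \<open>q\<close>.\<close>

lemma ext_shift:
  assumes "i \<le> k"
  shows "ext k q (shift S) i = ext k q v i + of_bool (i mod k \<in> S) - of_bool (0 \<in> S)"
  using assms k by (auto simp: ext_def shift_def)

text \<open>The differences \<open>[i \<in> S'] - [i \<in> S] + [0 \<in> S] - [0 \<in> S']\<close>
  have to be 0 or 1. For subsets of \<open>{..<k}\<close> the middle case occurs only if
  \<open>S\<close> is empty and \<open>S'\<close> is full.\<close>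

lemma below_shift_iff:
  "below k (shift S) (shift S') \<longleftrightarrow> (\<forall>i\<in>{1..k - 1}.
     if 0 \<in> S \<longleftrightarrow> 0 \<in> S' then i \<in> S \<longrightarrow> i \<in> S'
     else if 0 \<in> S' then i \<notin> S \<and> i \<in> S' else i \<in> S' \<longrightarrow> i \<in> S)"
  unfolding below_def by (rule ball_cong[OF refl]) (simp add: shift_def of_bool_def)

lemma subset_lessThan_iff:
  assumes "S \<subseteq> {..<k}"
  shows "S \<subseteq> S' \<longleftrightarrow> (0 \<in> S \<longrightarrow> 0 \<in> S') \<and> (\<forall>i\<in>{1..k - 1}. i \<in> S \<longrightarrow> i \<in> S')"
proof -
  have "i = 0 \<or> i \<in> {1..k - 1}" if "i \<in> S" for i
    using assms that by auto
  then show ?thesis by blast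
qed

text \<open>If \<open>0\<close> lies in both sets or in neither, \<open>below\<close> is inclusion.
  If it lies in one only, that set belongs to the lower point and the inclusion is reversed, apart
  from the pair of empty and full set. The symmetric \<open>adj\<close> forgets the
  direction.\<close>

lemma adj_shift_iff:
  assumes "S \<subseteq> {..<k}" "S' \<subseteq> {..<k}"
  shows "adj k (shift S) (shift S') \<longleftrightarrow> S \<subseteq> S' \<or> S' \<subseteq> S"
  unfolding adj_def below_shift_iff subset_lessThan_iff[OF assms(1)] subset_lessThan_iff[OF assms(2)]
  by (cases "0 \<in> S"; cases "0 \<in> S'"; simp; blast)

text \<open>Equal points are \<open>below\<close> each other both ways. If exactly one set contains
  \<open>0\<close>, this forces the empty and the full set, which differ by the all-ones vector that
  the normalisation removes.\<close>

lemma shift_inject: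
  assumes "S \<subseteq> {..<k}" "S' \<subseteq> {..<k}" "shift S = shift S'"
  shows "S = S' \<or> S = {} \<and> S' = {..<k} \<or> S = {..<k} \<and> S' = {}"
proof -
  have le: "below k (shift S) (shift S')" "below k (shift S') (shift S)"
    using assms(3) by (auto simp: below_def)
  have I: "i = 0 \<or> i \<in> {1..k - 1}" if "i < k" for i using that by auto
  show ?thesis
  proof (cases "0 \<in> S \<longleftrightarrow> 0 \<in> S'")
    case True
    then have "S \<subseteq> S'" "S' \<subseteq> S"
      using le unfolding below_shift_iff subset_lessThan_iff[OF assms(1)] subset_lessThan_iff[OF assms(2)]
      by simp_all
    then show ?thesis by blast
  next
    case False
    then consider "0 \<in> S'" "0 \<notin> S" | "0 \<in> S" "0 \<notin> S'" by blast
    then show ?thesis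
    proof cases
      case 1
      then have "\<forall>i\<in>{1..k - 1}. i \<notin> S \<and> i \<in> S'" using le(1) unfolding below_shift_iff by simp
      then show ?thesis using 1 I assms(1,2) by blast
    next
      case 2
      then have "\<forall>i\<in>{1..k - 1}. i \<notin> S' \<and> i \<in> S" using le(2) unfolding below_shift_iff by simp
      then show ?thesis using 2 I assms(1,2) by blast
    qed
  qed
qed

lemma v_mono: "i < k \<Longrightarrow> ext k q v i \<le> ext k q v (Suc i)"
  using v W_points_iff[OF k] by blast

text \<open>By \<open>ext_shift\<close> only the change of the indicator from \<open>i\<close> to
  its cyclic successor matters. A jump of \<open>v\<close>, being at least 1, absorbs a change of
  -1; where \<open>v\<close> is constant, such a change is fatal.\<close>

lemma shift_in_W_points_iff:
  assumes "S \<subseteq> {..<k}"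
  shows "shift S \<in> W_points k q \<longleftrightarrow> upset S"
proof -
  have vE: "v \<in> {1..k - 1} \<rightarrow>\<^sub>E \<int>" using v W_points_iff[OF k] by blast
  then have "shift S \<in> {1..k - 1} \<rightarrow>\<^sub>E \<int>" by (auto simp: shift_def PiE_def Pi_def)
  moreover have "ext k q (shift S) i \<le> ext k q (shift S) (Suc i) \<longleftrightarrow>
      (i \<in> S \<longrightarrow> ext k q v i = ext k q v (Suc i) \<longrightarrow> Suc i mod k \<in> S)" if i: "i < k" for i
  proof -
    have "ext k q v i + 1 \<le> ext k q v (Suc i)" if "ext k q v i \<noteq> ext k q v (Suc i)"
      using that v_mono[OF i] i by (intro Ints_less_imp_add_one_le ext_Ints[OF vE]) auto
    moreover have "i mod k = i" using i by simp
    ultimately show ?thesis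
      using i v_mono[OF i] by (cases "ext k q v i = ext k q v (Suc i)") (auto simp: ext_shift of_bool_def)
  qed
  ultimately show ?thesis
    using assms unfolding W_points_iff[OF k] upset_def by blast
qed

lemma ex_shift_eq:
  assumes x: "x \<in> W_points k q" "adj k v x"
  shows "\<exists>S. upset S \<and> x = shift S"
proof -
  have xE: "x \<in> extensional {1..k - 1}" using x(1) by (auto simp: W_points_def PiE_def)
  have "\<exists>S \<subseteq> {..<k}. x = shift S"
  proof (cases "below k v x")
    case True
    let ?S = "{i \<in> {1..k - 1}. x i = v i + 1}"
    have "x i = shift ?S i" for i
      using below_cases[OF v x(1) True, of i] xE by (auto simp: shift_def extensional_def)
    then have "x = shift ?S" by blast
    moreover have "?S \<subseteq> {..<k}" by auto
    ultimately show ?thesis by blast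
  next
    case False
    then have "below k x v" using x(2) by (simp add: adj_def)
    \<comment> \<open>Below \<open>v\<close>, the set consists of \<open>0\<close> and the
      coordinates that are not lowered.\<close>
    let ?S = "insert 0 {i \<in> {1..k - 1}. x i = v i}"
    have "x i = shift ?S i" for i
      using below_cases[OF x(1) v \<open>below k x v\<close>, of i] xE by (auto simp: shift_def extensional_def)
    then have "x = shift ?S" by blast
    moreover have "?S \<subseteq> {..<k}" using k by auto
    ultimately show ?thesis by blast
  qed
  then show ?thesis using shift_in_W_points_iff x(1) by blast
qed

text \<open>The two deleted list elements give the empty and the full set, and by
  \<open>shift_inject\<close> these are the only sets whose shift is \<open>v\<close>
  itself.\<close>

lemma bij_betw_shift_upset_of:
  "bij_betw (\<lambda>c. shift (upset_of c)) (P_poset ps - {replicate (length ps) 0, ps})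
     {x \<in> W_points k q. x \<noteq> v \<and> adj k v x}"
proof -
  let ?A = "P_poset ps - {replicate (length ps) 0, ps}"
  have sub: "upset_of c \<subseteq> {..<k}" for c by (auto simp: upset_of_def)
  have proper: "upset_of c \<noteq> {}" "upset_of c \<noteq> {..<k}" if "c \<in> ?A" for c
    using that inj_on_upset_of upset_of_bot upset_of_top bot_top_in_P_poset
    by (metis Diff_iff inj_onD insertCI)+
  have k0: "{..<k} \<noteq> {}" using k by (auto simp: lessThan_empty_iff)
  have "inj_on (\<lambda>c. shift (upset_of c)) ?A"
  proof (rule inj_onI)
    fix c d assume c: "c \<in> ?A" and d: "d \<in> ?A" and eq: "shift (upset_of c) = shift (upset_of d)"
    then have "upset_of c = upset_of d"
      using shift_inject[OF sub sub eq] proper[OF c] proper[OF d] by blast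
    then show "c = d" using c d inj_on_upset_of by (auto dest: inj_onD)
  qed
  moreover have "shift (upset_of c) \<in> {x \<in> W_points k q. x \<noteq> v \<and> adj k v x}" if c: "c \<in> ?A" for c
  proof -
    have "adj k v (shift (upset_of c))"
      using adj_shift_iff[OF _ sub, of "{}" c] v_eq_shift by simp
    moreover have "shift (upset_of c) \<noteq> shift {}"
      using shift_inject[OF sub, of "{}" c] proper[OF c] k0 by blast
    ultimately show ?thesis
      using shift_in_W_points_iff[OF sub] upset_upset_of v_eq_shift by simp
  qed
  moreover have "x \<in> (\<lambda>c. shift (upset_of c)) ` ?A"
    if x: "x \<in> W_points k q" "x \<noteq> v" "adj k v x" for x
  proof -
    obtain S where S: "upset S" "x = shift S" using ex_shift_eq x by blast
    then obtain c where c: "c \<in> P_poset ps" "upset_of c = S" using ex_upset_of_eq by blast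
    have "shift {..<k} = shift {}" using k by (auto simp: shift_def fun_eq_iff)
    then have "S \<noteq> {}" "S \<noteq> {..<k}" using S(2) x(2) v_eq_shift by auto
    then have "c \<in> ?A" using c upset_of_bot upset_of_top by auto
    then show ?thesis using c S by blast
  qed
  ultimately show ?thesis by (auto simp: bij_betw_def)
qed

lemma complex_iso_link:
  assumes q: "q \<ge> 1"
  shows "complex_iso (link (T_complex k q) {v}) (K_complex ps)"
proof -
  have sub: "upset_of c \<subseteq> {..<k}" for c by (auto simp: upset_of_def)
  have "link (T_complex k q) {v} = flag_complex {x \<in> W_points k q. x \<noteq> v \<and> adj k v x} (adj k)"
    unfolding T_complex_eq_flag_complex[OF k q]
    using v adj_refl adj_commute by (intro link_flag_complex) auto
  also have "complex_iso \<dots> (K_complex ps)"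
    unfolding K_complex_eq_flag_complex
    by (rule complex_iso_flag_complex'[OF bij_betw_shift_upset_of])
      (auto simp: adj_shift_iff[OF sub sub] upset_of_subset_iff list_all2_refl)
  finally show ?thesis .
qed

end

section \<open>Block coordinates on a cyclic word\<close>

text \<open>\<open>E i\<close> says that \<open>i\<close> and its cyclic successor share a block. So
  \<open>n0\<close> ends a block, every position reaches an end by moving forward, and blocks can be
  indexed by their ends.\<close>

lemma ex_cyclic_block_coordinates:
  fixes E :: "nat \<Rightarrow> bool"
  assumes n0: "n0 < k" "\<not> E n0"
  shows "\<exists>ps\<in>Par k (card {i. i < k \<and> \<not> E i}). \<exists>b r.
    bij_betw (\<lambda>i. (b i, r i)) {..<k} {(j, t). j < length ps \<and> t < ps ! j} \<and>
    (\<forall>i<k. E i \<longrightarrow> b (Suc i mod k) = b i \<and> r i = Suc (r (Suc i mod k))) \<and>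
    (\<forall>i<k. \<not> E i \<longrightarrow> r i = 0)"
proof -
  have k: "k > 0" using n0 by simp
  define N where "N = {i. i < k \<and> \<not> E i}"
  \<comment> \<open>\<open>r i\<close> counts the steps to the next block end, and
    \<open>e i\<close> is that end.\<close>
  define r where "r i = (LEAST t. \<not> E ((i + t) mod k))" for i
  define e where "e i = (i + r i) mod k" for i
  have ex: "\<exists>t. \<not> E ((i + t) mod k)" if "i < k" for i
  proof
    \<comment> \<open>Adding \<open>k\<close> avoids a truncated subtraction when
      \<open>n0 < i\<close>.\<close>
    have "(i + (n0 + k - i)) mod k = n0" using that n0 by simp
    then show "\<not> E ((i + (n0 + k - i)) mod k)" using n0 by simp
  qed
  have eN: "e i \<in> N" if "i < k" for i
    using LeastI_ex[OF ex[OF that]] k by (simp add: N_def e_def r_def)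
  have r0: "r i = 0" if "i < k" "\<not> E i" for i
    unfolding r_def by (rule Least_eq_0) (use that in simp)
  have rS: "r i = Suc (r (Suc i mod k))" if i: "i < k" "E i" for i
  proof -
    obtain t where "\<not> E ((i + t) mod k)" using ex[OF i(1)] by blast
    then have "r i = Suc (LEAST t. \<not> E ((i + Suc t) mod k))"
      unfolding r_def by (rule Least_Suc) (use i in simp)
    then show ?thesis by (simp add: r_def mod_add_left_eq)
  qed
  have eS: "e (Suc i mod k) = e i" if "i < k" "E i" for i
    using rS[OF that] by (simp add: e_def mod_add_left_eq)
  have inj: "i = i'" if "i < k" "i' < k" "e i = e i'" "r i = r i'" for i i'
  proof -
    have "i = i'" if "i < k" "i' < k" "(i + t) mod k = (i' + t) mod k" "i \<le> i'" for i i' t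
    proof -
      have "k dvd i' - i"
        using mod_eq_dvd_iff_nat[of "i + t" "i' + t" k] that by simp
      then show ?thesis using that by (auto dest: dvd_imp_le)
    qed
    then show ?thesis using that unfolding e_def by (metis nle_le)
  qed
  define C where "C n = {i. i < k \<and> e i = n}" for n
  have finC: "finite (C n)" for n by (simp add: C_def)
  have rC: "r ` C n = {..<card (C n)}" for n
  proof -
    have "r ` C n = {..<card (r ` C n)}"
    proof (rule downset_eq_lessThan_card)
      fix t assume "Suc t \<in> r ` C n"
      then obtain i where i: "i < k" "e i = n" "r i = Suc t" by (auto simp: C_def)
      then have "E i" using r0[of i] by force
      then have "Suc i mod k \<in> C n" "r (Suc i mod k) = t"
        using i rS[of i] eS[of i] k by (auto simp: C_def)
      then show "t \<in> r ` C n" by blast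
    qed (simp add: finC)
    moreover have "inj_on r (C n)"
      by (rule inj_onI) (use inj in \<open>auto simp: C_def\<close>)
    ultimately show ?thesis by (simp add: card_image)
  qed
  \<comment> \<open>Blocks are listed by decreasing size because \<open>Par\<close> asks for weakly
    decreasing parts.\<close>
  define ns where "ns = rev (sort_key (\<lambda>n. card (C n)) (sorted_list_of_set N))"
  have finN: "finite N" by (simp add: N_def)
  have ns: "set ns = N" "distinct ns" using finN by (simp_all add: ns_def)
  have len: "length ns = card N" using distinct_card[OF ns(2)] ns(1) by simp
  define ps where "ps = map (\<lambda>n. card (C n)) ns"
  have "sum_list ps = (\<Sum>n\<in>N. card (C n))"
    using sum.distinct_set_conv_list[OF ns(2), of "\<lambda>n. card (C n)"] ns(1) by (simp add: ps_def)
  also have "\<dots> = card (\<Union>n\<in>N. C n)"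
    using finN finC by (intro card_UN_disjoint[symmetric]) (auto simp: C_def)
  also have "(\<Union>n\<in>N. C n) = {..<k}" using eN by (auto simp: C_def)
  finally have "sum_list ps = k" by simp
  moreover have "0 < card (C n)" if "n \<in> N" for n
  proof -
    have "n \<in> C n" using that r0[of n] by (simp add: C_def N_def e_def)
    then show ?thesis using finC card_gt_0_iff by blast
  qed
  moreover have "sorted_wrt (\<ge>) ps"
    using sorted_sort_key[of "\<lambda>n. card (C n)" "sorted_list_of_set N"]
    by (simp add: ps_def ns_def sorted_wrt_map sorted_wrt_rev sorted_map)
  ultimately have ps: "ps \<in> Par k (card N)"
    using ns(1) len by (auto simp: Par_def ps_def)
  have bij: "bij_betw ((!) ns) {..<length ns} N"
    using bij_betw_nth[OF ns(2) refl ns(1)[symmetric]] .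
  define b where "b i = inv_into {..<length ns} ((!) ns) (e i)" for i
  have b: "b i < length ns" "ns ! b i = e i" if "i < k" for i
    using bij eN[OF that] inv_into_into[of "e i" "(!) ns" "{..<length ns}"]
      f_inv_into_f[of "e i" "(!) ns" "{..<length ns}"]
    by (simp_all add: b_def bij_betw_def)
  have "bij_betw (\<lambda>i. (b i, r i)) {..<k} {(j, t). j < length ps \<and> t < ps ! j}"
    unfolding bij_betw_def
  proof (intro conjI equalityI subsetI)
    show "inj_on (\<lambda>i. (b i, r i)) {..<k}"
      using inj b by (auto simp: inj_on_def) metis
  next
    fix x assume "x \<in> (\<lambda>i. (b i, r i)) ` {..<k}"
    then obtain i where i: "i < k" "x = (b i, r i)" by auto
    then have "r i \<in> r ` C (e i)" by (auto simp: C_def)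
    then have "r i < card (C (e i))" using rC by blast
    then show "x \<in> {(j, t). j < length ps \<and> t < ps ! j}"
      using i b[OF i(1)] by (simp add: ps_def)
  next
    fix x assume "x \<in> {(j, t). j < length ps \<and> t < ps ! j}"
    then obtain j t where x: "x = (j, t)" "j < length ns" "t < card (C (ns ! j))"
      by (auto simp: ps_def)
    then have "t \<in> r ` C (ns ! j)" using rC by blast
    then obtain i where i: "i < k" "e i = ns ! j" "r i = t" by (auto simp: C_def)
    then have "b i = j"
      using b[OF i(1)] x(2) ns(2) nth_eq_iff_index_eq by metis
    then show "x \<in> (\<lambda>i. (b i, r i)) ` {..<k}" using x i by auto
  qed
  moreover have "\<forall>i<k. E i \<longrightarrow> b (Suc i mod k) = b i \<and> r i = Suc (r (Suc i mod k))"
    using eS rS by (simp add: b_def)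
  ultimately show ?thesis using ps r0 unfolding N_def by blast
qed

text \<open>The differences of the extended word telescope to \<open>q\<close>, and by monotonicity
  and integrality each nonzero one is at least 1. As \<open>q > 0\<close>, they do not all
  vanish.\<close>

lemma card_jumps:
  assumes k: "k \<ge> 2" and q: "q \<ge> 1" and v: "v \<in> W_points k q"
  shows "card {i. i < k \<and> ext k q v i \<noteq> ext k q v (Suc i)} \<in> {1..q}"
proof -
  let ?d = "\<lambda>i. ext k q v (Suc i) - ext k q v i"
  let ?N = "{i. i < k \<and> ext k q v i \<noteq> ext k q v (Suc i)}"
  have vE: "v \<in> {1..k - 1} \<rightarrow>\<^sub>E \<int>" and mono: "\<And>i. i < k \<Longrightarrow> ext k q v i \<le> ext k q v (Suc i)"
    using v W_points_iff[OF k] by auto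
  have "(\<Sum>i<k. ?d i) = ext k q v k - ext k q v 0" by (rule sum_lessThan_telescope)
  also have "\<dots> = real q" using k by (simp add: ext_def)
  also have "(\<Sum>i<k. ?d i) = (\<Sum>i\<in>?N. ?d i)" by (rule sum.mono_neutral_right) auto
  finally have sum: "(\<Sum>i\<in>?N. ?d i) = real q" .
  have "1 \<le> ?d i" if "i \<in> ?N" for i
    using that mono[of i] Ints_less_imp_add_one_le[OF ext_Ints[OF vE, of i q] ext_Ints[OF vE, of "Suc i" q]]
    by auto
  then have "real (card ?N) * 1 \<le> (\<Sum>i\<in>?N. ?d i)" by (intro sum_bounded_below) auto
  then have "card ?N \<le> q" using sum by simp
  moreover have "?N \<noteq> {}" using sum q by (metis (no_types, lifting) not_one_le_zero of_nat_eq_0_iff sum.empty)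
  then have "0 < card ?N" by (subst card_gt_0_iff) auto
  ultimately show ?thesis by simp
qed

lemma ex_cyclic_blocks:
  assumes k: "k \<ge> 2" and q: "q \<ge> 1" and v: "v \<in> W_points k q"
  shows "\<exists>s\<in>{1..q}. \<exists>ps\<in>Par k s. \<exists>b r. cyclic_blocks k q v ps b r"
proof -
  let ?E = "\<lambda>i. ext k q v i = ext k q v (Suc i)"
  have card: "card {i. i < k \<and> \<not> ?E i} \<in> {1..q}" using card_jumps[OF assms] .
  then have "{i. i < k \<and> \<not> ?E i} \<noteq> {}" by (metis atLeastAtMost_iff card.empty not_one_le_zero)
  then obtain n0 where "n0 < k" "\<not> ?E n0" by blast
  from ex_cyclic_block_coordinates[of n0 k ?E, OF this] obtain ps b r where
    "ps \<in> Par k (card {i. i < k \<and> \<not> ?E i})"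
    "bij_betw (\<lambda>i. (b i, r i)) {..<k} {(j, t). j < length ps \<and> t < ps ! j}"
    "\<forall>i<k. ?E i \<longrightarrow> b (Suc i mod k) = b i \<and> r i = Suc (r (Suc i mod k))"
    "\<forall>i<k. \<not> ?E i \<longrightarrow> r i = 0"
    by blast
  moreover from this have "cyclic_blocks k q v ps b r"
    using k v by unfold_locales auto
  ultimately show ?thesis using card by blast
qed

section \<open>Realising a given partition\<close>

text \<open>Cut \<open>{..<k}\<close> into consecutive intervals whose lengths are the parts and let
  each entry be the number of its interval, starting at 0. The entries are at most
  \<open>s - 1\<close>, so \<open>s \<le> q\<close> leaves a jump before the final
  \<open>q\<close>.\<close>

lemma ex_vertex_with_blocks:
  assumes k: "k \<ge> 2" and s: "s \<in> {1..q}" and ps: "ps \<in> Par k s"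
  shows "\<exists>v b r. cyclic_blocks k q v ps b r"
proof -
  have len: "length ps = s" and sum: "sum_list ps = k" and pos: "\<And>p. p \<in> set ps \<Longrightarrow> 0 < p"
    using ps by (auto simp: Par_def)
  define P where "P j = sum_list (take j ps)" for j
  have P0: "P 0 = 0" and Ps: "P s = k" using len sum by (simp_all add: P_def)
  have PS: "P (Suc j) = P j + ps ! j" if "j < s" for j
    using that len by (simp add: P_def take_Suc_conv_app_nth)
  have P_mono: "P i \<le> P j" if "i \<le> j" for i j
    using that by (auto simp: P_def le_iff_add take_add)
  \<comment> \<open>\<open>b i\<close> is the \<open>j\<close> whose interval
    \<open>{P j..<P (Suc j)}\<close> contains \<open>i\<close>, and \<open>r i\<close> is the
    distance to its last element \<open>P (Suc (b i)) - 1\<close>.\<close>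
  define b where "b i = (LEAST j. i < P (Suc j))" for i
  define r where "r i = P (Suc (b i)) - 1 - i" for i
  have s0: "Suc (s - 1) = s" using s by auto
  have b_less: "i < P (Suc (b i))" "b i < s" if "i < k" for i
  proof -
    have *: "i < P (Suc (s - 1))" using that Ps s0 by simp
    show "i < P (Suc (b i))" unfolding b_def using * by (rule LeastI)
    have "b i \<le> s - 1" unfolding b_def using * by (rule Least_le)
    then show "b i < s" using s0 by linarith
  qed
  have b_eq: "b i = j" if "P j \<le> i" "i < P (Suc j)" for i j
    unfolding b_def
  proof (rule Least_equality)
    show "j \<le> l" if "i < P (Suc l)" for l
      using P_mono[of "Suc l" j] that \<open>P j \<le> i\<close> by (cases "j \<le> l") auto
  qed (use that in simp)
  have P_b: "P (b i) \<le> i" for i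
  proof (cases "b i")
    case (Suc j)
    then have "\<not> i < P (Suc j)" unfolding b_def by (intro not_less_Least) simp
    then show ?thesis using Suc by simp
  qed (simp add: P0)
  have b_mono: "b i \<le> b i'" if "i \<le> i'" "i' < k" for i i'
    unfolding b_def[of i] using b_less(1)[OF that(2)] that(1) by (intro Least_le) simp
  have b0: "b 0 = 0"
    using PS[of 0] P0 pos[of "ps ! 0"] s len by (intro b_eq) auto
  define v where "v = (\<lambda>i\<in>{1..k - 1}. real (b i))"
  have ext_v: "ext k q v i = real (b i)" if "i < k" for i
    using that b0 by (auto simp: ext_def v_def)
  have ext_k: "ext k q v k = real q" using k by (simp add: ext_def)
  \<comment> \<open>This jump separates \<open>k - 1\<close> from \<open>0\<close>, so no block
    wraps around.\<close>
  have ext_less: "ext k q v (k - 1) < ext k q v k"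
    using ext_v[of "k - 1"] ext_k b_less(2)[of "k - 1"] k s by auto
  have last: "Suc i = k \<longleftrightarrow> i = k - 1" for i using k by auto
  have v: "v \<in> W_points k q"
    unfolding W_points_iff[OF k]
  proof (intro conjI allI impI)
    fix i assume "i < k"
    then show "ext k q v i \<le> ext k q v (Suc i)"
      using ext_less ext_v[of i] ext_v[of "Suc i"] b_mono[of i "Suc i"] last[of i]
      by (cases "Suc i = k") auto
  qed (auto simp: v_def)
  have "cyclic_blocks k q v ps b r"
  proof
    show "bij_betw (\<lambda>i. (b i, r i)) {..<k} {(j, t). j < length ps \<and> t < ps ! j}"
      unfolding bij_betw_def
    proof (intro conjI equalityI subsetI)
      show "inj_on (\<lambda>i. (b i, r i)) {..<k}"
      proof (rule inj_onI)
        fix i i' assume "i \<in> {..<k}" "i' \<in> {..<k}" "(b i, r i) = (b i', r i')"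
        then show "i = i'" using b_less(1)[of i] b_less(1)[of i'] by (auto simp: r_def)
      qed
    next
      fix x assume "x \<in> (\<lambda>i. (b i, r i)) ` {..<k}"
      then obtain i where i: "i < k" "x = (b i, r i)" by auto
      then show "x \<in> {(j, t). j < length ps \<and> t < ps ! j}"
        using b_less[OF i(1)] P_b[of i] PS[of "b i"] len by (auto simp: r_def)
    next
      fix x assume "x \<in> {(j, t). j < length ps \<and> t < ps ! j}"
      then obtain j t where x: "x = (j, t)" "j < s" "t < ps ! j" using len by auto
      let ?i = "P (Suc j) - 1 - t"
      have "b ?i = j" using PS[OF x(2)] x(3) by (intro b_eq) auto
      moreover have "?i < k" using P_mono[of "Suc j" s] PS[OF x(2)] x Ps by auto
      moreover have "r ?i = t" using \<open>b ?i = j\<close> PS[OF x(2)] x(3) by (simp add: r_def)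
      ultimately show "x \<in> (\<lambda>i. (b i, r i)) ` {..<k}" using x(1) by force
    qed
  next
    fix i assume i: "i < k" "ext k q v i = ext k q v (Suc i)"
    then have "Suc i < k" using ext_less last[of i] by (cases "Suc i = k") auto
    then show "b (Suc i mod k) = b i \<and> r i = Suc (r (Suc i mod k))"
      using i ext_v[of i] ext_v[of "Suc i"] b_less(1)[of "Suc i"] by (auto simp: r_def)
  next
    fix i assume i: "i < k" "ext k q v i \<noteq> ext k q v (Suc i)"
    \<comment> \<open>A change of entry, or the end of the word, makes \<open>i\<close> the last
      element of its interval; the subtraction in \<open>r\<close> then gives 0.\<close>
    have "P (Suc (b i)) \<le> Suc i"
    proof (rule ccontr)
      assume *: "\<not> ?thesis"
      then have "Suc i < k" using P_mono[of "Suc (b i)" s] b_less(2)[OF i(1)] Ps by auto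
      moreover have "b (Suc i) = b i" using * P_b[of i] by (intro b_eq) auto
      ultimately show False using i ext_v[of i] ext_v[of "Suc i"] by simp
    qed
    then show "r i = 0" by (simp add: r_def)
  qed (use k v in auto)
  then show ?thesis by blast
qed

theorem mainTheorem3:
  fixes k q :: nat
  assumes "k \<ge> 2" and "q \<ge> 1"
  shows "(\<forall>v \<in> vertices (T_complex k q). \<exists>s \<in> {1..q}. \<exists>ps \<in> Par k s.
            complex_iso (link (T_complex k q) {v}) (K_complex ps)) \<and>
         (\<forall>s \<in> {1..q}. \<forall>ps \<in> Par k s. \<exists>v \<in> vertices (T_complex k q).
            complex_iso (link (T_complex k q) {v}) (K_complex ps))"
proof -
  have vert: "vertices (T_complex k q) = W_points k q"
    unfolding T_complex_eq_flag_complex[OF assms]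
    by (rule vertices_flag_complex) (rule adj_refl)
  show ?thesis
    unfolding vert
  proof (intro conjI ballI)
    fix v assume "v \<in> W_points k q"
    then show "\<exists>s \<in> {1..q}. \<exists>ps \<in> Par k s. complex_iso (link (T_complex k q) {v}) (K_complex ps)"
      using ex_cyclic_blocks[OF assms] cyclic_blocks.complex_iso_link[OF _ assms(2)] by meson
  next
    fix s ps assume "s \<in> {1..q}" "ps \<in> Par k s"
    then obtain v b r where blocks: "cyclic_blocks k q v ps b r"
      using ex_vertex_with_blocks[OF assms(1)] by blast
    then show "\<exists>v \<in> W_points k q. complex_iso (link (T_complex k q) {v}) (K_complex ps)"
      using cyclic_blocks.complex_iso_link[OF blocks assms(2)] cyclic_blocks.v[OF blocks] by blast
  qed
qed

end
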